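(* Let $n\ge2$, let $\alpha_1,\dots,\alpha_n>0$ be pairwise distinct, and let $T$ follow the hypoexponential distribution with parameters $(\alpha_1,\dots,\alpha_n)$, so that $f_T(t)=\sum_{i=1}^n\frac{f_{X_i}(t)}{P_i}$, $t>0$, where $X_i\sim\mathrm{Exp}(\alpha_i)$ and $P_i=\prod_{j=1,\,j\ne i}^n\left(1-\frac{\alpha_i}{\alpha_j}\right)$. Let $c>0$ and consider $Y_i=c\,e^{X_i}\sim\mathrm{Pareto}(c,\alpha_i)$. Then the resulting new distribution, the Mixed Hypoexponential Pareto distribution $Z\sim MHT(k,\lambda_1,\dots,\lambda_n)$ (with $k=c$, $\lambda_i=\alpha_i$), has PDF $$f_Z(t)=\sum_{i=1}^n\frac{1}{PT_i}f_{Y_i}(t),$$ where $Y_i\sim\mathrm{Pareto}(k,\lambda_i)$ and $PT_i=\prod_{j=1,\,j\ne i}^{n}\left(1-\frac{\lambda_i}{\lambda_j}\right)$.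
   Context: $\mathrm{Exp}(\alpha)$ is the exponential distribution with rate $\alpha$. The hypoexponential distribution with parameters $(\alpha_1,\dots,\alpha_n)$ is the law of the sum of independent $X_i\sim\mathrm{Exp}(\alpha_i)$. $\mathrm{Pareto}(k,\lambda)$ is defined as the Pareto distribution of the first kind with shape parameter $k>0$ and scale parameter $\lambda>0$, with PDF $f(t)=\frac{k\lambda^k}{t^{k+1}}$ and cumulative distribution function $F(t)=1-\left(\frac{\lambda}{t}\right)^k$. If a distribution $T$ has PDF $\sum_iA_if_{X_i}$ with $A_i\in\mathbb{R}$, $\sum_iA_i=1$, and $g$ is a one-to-one function, the mixed T-G distribution generated from $T$ and $g$ is the distribution with PDF $\sum_iA_if_{g(X_i)}$; the Mixed Hypoexponential Pareto distribution is the one generated from the hypoexponential distribution by $g(x)=c\,e^x$.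
   Formalization: The Pareto parameters are swapped: with Pareto(shape, scale) as defined, c e^{X_i} is Pareto(α_i, c), not Pareto(c, α_i); the result is proved with Y_i having shape λ_i=α_i and scale k=c. *)

theory Defs
  imports "HOL-Probability.Probability"
begin

text \<open>A density is only determined up to null sets, hence nonnegativity almost everywhere.
  It has to be required, since \<^const>\<open>ennreal\<close> truncates negative values.\<close>

definition has_pdf :: "real measure \<Rightarrow> (real \<Rightarrow> real) \<Rightarrow> bool" where
  "has_pdf \<mu> f \<longleftrightarrow> real_distribution \<mu> \<and> f \<in> borel_measurable borel \<and>
     (AE t in lborel. 0 \<le> f t) \<and> \<mu> = density lborel (\<lambda>t. ennreal (f t))"

definition exponential_law :: "real \<Rightarrow> real measure" where
  "exponential_law a = density lborel (\<lambda>t. ennreal (exponential_density a t))"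

text \<open>The law of the sum of independent variables with laws
  \<^term>\<open>exponential_law (\<alpha> i)\<close>, realised on the product space;
  see \<open>distr_sum_eq_hypoexponential_law\<close> below.\<close>

definition hypoexponential_law :: "nat \<Rightarrow> (nat \<Rightarrow> real) \<Rightarrow> real measure" where
  "hypoexponential_law n \<alpha> =
     distr (Pi\<^sub>M {1..n} (\<lambda>i. exponential_law (\<alpha> i))) borel (\<lambda>x. \<Sum>i=1..n. x i)"

definition hypoexp_coeff :: "nat \<Rightarrow> (nat \<Rightarrow> real) \<Rightarrow> nat \<Rightarrow> real" where
  "hypoexp_coeff n \<alpha> i = (\<Prod>j\<in>{1..n} - {i}. 1 - \<alpha> i / \<alpha> j)"

text \<open>Shape \<open>k\<close> first, scale \<open>s\<close> second.\<close>

definition pareto_density :: "real \<Rightarrow> real \<Rightarrow> real \<Rightarrow> real" where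
  "pareto_density k s t = (if t < s then 0 else k * s powr k / t powr (k + 1))"

text \<open>\<open>Z\<close> is generated by \<open>g\<close> from the representation
  \<open>f\<^sub>T = (\<Sum>i=1..m. A i * f i)\<close>, where \<open>f i\<close> is a density of \<open>X i\<close>
  and \<open>h i\<close> one of the image of \<open>X i\<close> under \<open>g\<close>.
  The weights \<open>A i\<close> may be negative.\<close>

definition mixed_TG_via ::
  "nat \<Rightarrow> (nat \<Rightarrow> real) \<Rightarrow> (nat \<Rightarrow> real measure) \<Rightarrow> real measure \<Rightarrow> (real \<Rightarrow> real) \<Rightarrow> real measure \<Rightarrow> bool"
where
  "mixed_TG_via m A X T g Z \<longleftrightarrow>
     (\<Sum>i=1..m. A i) = 1 \<and> inj g \<and> g \<in> borel_measurable borel \<and>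
     (\<exists>f h. (\<forall>i\<in>{1..m}. has_pdf (X i) (f i)) \<and> has_pdf T (\<lambda>t. \<Sum>i=1..m. A i * f i t) \<and>
            (\<forall>i\<in>{1..m}. has_pdf (distr (X i) borel g) (h i)) \<and> has_pdf Z (\<lambda>t. \<Sum>i=1..m. A i * h i t))"

definition mixed_TG :: "real measure \<Rightarrow> (real \<Rightarrow> real) \<Rightarrow> real measure \<Rightarrow> bool" where
  "mixed_TG T g Z \<longleftrightarrow> (\<exists>m A X. mixed_TG_via m A X T g Z)"

definition mixed_hypoexponential_pareto :: "nat \<Rightarrow> real \<Rightarrow> (nat \<Rightarrow> real) \<Rightarrow> real measure \<Rightarrow> bool" where
  "mixed_hypoexponential_pareto n c \<alpha> Z \<longleftrightarrow>
     mixed_TG (hypoexponential_law n \<alpha>) (\<lambda>x. c * exp x) Z"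

lemma (in prob_space) distr_sum_eq_hypoexponential_law:
  assumes "n \<ge> 1"
    and indep: "indep_vars (\<lambda>_. borel) X {1..n}"
    and X: "\<And>i. i \<in> {1..n} \<Longrightarrow> distr M borel (X i) = exponential_law (\<alpha> i)"
  shows "distr M borel (\<lambda>\<omega>. \<Sum>i=1..n. X i \<omega>) = hypoexponential_law n \<alpha>"
proof -
  have rv: "\<And>i. i \<in> {1..n} \<Longrightarrow> X i \<in> borel_measurable M"
    using indep by (auto simp: indep_vars_def)
  have "distr M (Pi\<^sub>M {1..n} (\<lambda>_. borel)) (\<lambda>\<omega>. \<lambda>i\<in>{1..n}. X i \<omega>)
      = Pi\<^sub>M {1..n} (\<lambda>i. distr M borel (X i))"
    using indep_vars_iff_distr_eq_PiM'[where I="{1..n}" and X=X and M'="\<lambda>_. borel"] indep rv assms(1)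
    by auto
  also have "\<dots> = Pi\<^sub>M {1..n} (\<lambda>i. exponential_law (\<alpha> i))"
    by (rule PiM_cong) (auto simp: X)
  finally have eq: "Pi\<^sub>M {1..n} (\<lambda>i. exponential_law (\<alpha> i))
      = distr M (Pi\<^sub>M {1..n} (\<lambda>_. borel)) (\<lambda>\<omega>. \<lambda>i\<in>{1..n}. X i \<omega>)" by simp
  show ?thesis
    unfolding hypoexponential_law_def eq
    by (subst distr_distr) (auto intro!: measurable_restrict rv distr_cong)
qed

end

theory Submission
  imports Defs
begin

text \<open>
  Adding one independent exponential variable to a mixture of exponentials multiplies each weight
  \<open>w i\<close> by \<open>1 / (1 - a i / b)\<close> and puts the remaining mass on the new rate \<open>b\<close>; that this mass is
  again of product form is Lagrange interpolation of the constant \<open>1\<close> at the rates, evaluated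
  at \<open>b\<close>. For the transformed law no change of variables is needed: integrating the given signed
  mixtures over \<open>B\<close> and over the preimage of \<open>B\<close> shows that any \<open>Z\<close> generated from \<open>T\<close>
  by \<open>g\<close> is the image of \<open>T\<close> under \<open>g\<close>, whatever representation was chosen. This gives uniqueness,
  and nonnegativity of the mixed density almost everywhere.
\<close>

section \<open>Lagrange interpolation of a constant\<close>

text \<open>As a function of \<open>x\<close> the left side is a polynomial of degree below
  \<open>card I\<close> with value 1 at each of the \<open>card I\<close> distinct nodes, so it is
  the constant 1.\<close>

lemma sum_lagrange_basis:
  fixes a :: "'i \<Rightarrow> real"
  assumes "finite I" "I \<noteq> {}" "inj_on a I"
  shows "(\<Sum>i\<in>I. \<Prod>j\<in>I - {i}. (x - a j) / (a i - a j)) = 1"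
proof -
  define p where
    "p = (\<Sum>i\<in>I. \<Prod>j\<in>I - {i}. [:- a j / (a i - a j), 1 / (a i - a j):])"
  have poly_p: "poly p y = (\<Sum>i\<in>I. \<Prod>j\<in>I - {i}. (y - a j) / (a i - a j))" for y
    by (simp add: p_def poly_sum poly_prod diff_divide_distrib)
  have card_pos: "card I > 0"
    using assms by (simp add: card_gt_0_iff)
  have deg: "degree p < card I"
    unfolding p_def
  proof (rule degree_sum_less[OF _ card_pos])
    fix i assume i: "i \<in> I"
    have "degree (\<Prod>j\<in>I - {i}. [:- a j / (a i - a j), 1 / (a i - a j):])
      \<le> (\<Sum>j\<in>I - {i}. degree [:- a j / (a i - a j), 1 / (a i - a j):])"
      using degree_prod_sum_le[of "I - {i}" "\<lambda>j. [:- a j / (a i - a j), 1 / (a i - a j):]"] assms(1)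
      by (simp only: o_def finite_Diff)
    also have "\<dots> \<le> (\<Sum>j\<in>I - {i}. 1)"
      by (intro sum_mono) simp
    also have "\<dots> < card I"
      using i assms(1) card_pos by simp
    finally show "degree (\<Prod>j\<in>I - {i}. [:- a j / (a i - a j), 1 / (a i - a j):]) < card I" .
  qed
  have "p = 1"
  proof (rule poly_eqI_degree[where A = "a ` I"])
    fix y assume "y \<in> a ` I"
    then obtain k where k: "k \<in> I" "y = a k"
      by auto
    \<comment> \<open>At the node \<open>a k\<close> every product with \<open>i \<noteq> k\<close>
      contains the vanishing factor \<open>j = k\<close>.\<close>
    have "poly p y = (\<Sum>i\<in>I. if i = k then 1 else 0)"
      unfolding poly_p k(2)
    proof (rule sum.cong[OF refl])
      fix i assume i: "i \<in> I"
      show "(\<Prod>j\<in>I - {i}. (a k - a j) / (a i - a j)) = (if i = k then 1 else 0)"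
      proof (cases "i = k")
        case True
        then show ?thesis
          using inj_on_eq_iff[OF assms(3)] k(1) by (auto intro!: prod.neutral split: if_splits)
      next
        case False
        then show ?thesis
          using assms(1) k(1) by (auto intro!: prod_zero)
      qed
    qed
    also have "\<dots> = 1"
      using assms(1) k(1) by simp
    finally show "poly p y = poly 1 y"
      by simp
  qed (use deg card_pos assms(3) in \<open>simp_all add: card_image\<close>)
  then show ?thesis
    using poly_p[of x] by simp
qed

section \<open>Densities and signed mixtures\<close>

text \<open>Weights may be negative, so sums cannot be split under \<open>ennreal\<close>. Real
  integrals over Borel sets are linear in the density; this is the passage to them.\<close>

lemma has_pdf_integral:
  assumes "has_pdf \<mu> f"
  shows "integrable lborel f"
    and "B \<in> sets borel \<Longrightarrow> (LINT t:B|lborel. f t) = measure \<mu> B"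
proof -
  from assms have f[measurable]: "f \<in> borel_measurable borel"
    and nonneg: "AE t in lborel. 0 \<le> f t"
    and \<mu>: "\<mu> = density lborel (\<lambda>t. ennreal (f t))"
    and "real_distribution \<mu>"
    by (auto simp: has_pdf_def)
  then interpret real_distribution \<mu>
    by simp
  \<comment> \<open>Integrability of \<open>f\<close> is that of the constant 1 with respect to the
    probability measure \<open>\<mu>\<close>.\<close>
  show "integrable lborel f"
    using integrable_density[of "\<lambda>_. 1::real" lborel f] nonneg integrable_const[of "1::real"]
    by (simp flip: \<mu>)
  show "(LINT t:B|lborel. f t) = measure \<mu> B" if B[measurable]: "B \<in> sets borel"
  proof -
    have "(LINT t:B|lborel. f t) = integral\<^sup>L \<mu> (indicator B)"
      using integral_density[of "indicator B::real \<Rightarrow> real" lborel f] nonneg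
      by (simp add: set_lebesgue_integral_def mult.commute flip: \<mu>)
    then show ?thesis
      using B by simp
  qed
qed

text \<open>The way back from real integrals. Measures of sets are nonnegative, so \<open>f\<close>
  has a nonnegative integral over every Borel set and is therefore nonnegative almost everywhere;
  \<open>ennreal\<close> then truncates only on a null set.\<close>

lemma has_pdfI:
  assumes "real_distribution \<mu>" and f: "integrable lborel f"
    and eq: "\<And>B. B \<in> sets borel \<Longrightarrow> (LINT t:B|lborel. f t) = measure \<mu> B"
  shows "has_pdf \<mu> f"
proof -
  interpret real_distribution \<mu>
    by fact
  from f have [measurable]: "f \<in> borel_measurable borel"
    by auto
  have nonneg: "AE t in lborel. 0 \<le> f t"
    using sigma_finite_measure.density_nonneg[OF sigma_finite_lborel f] eq by simp
  have "\<mu> = density lborel (\<lambda>t. ennreal (f t))"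
  proof (rule measure_eqI)
    fix B assume "B \<in> sets \<mu>"
    then have B[measurable]: "B \<in> sets borel"
      by simp
    have "emeasure (density lborel (\<lambda>t. ennreal (f t))) B
        = (\<integral>\<^sup>+t. ennreal (indicator B t * f t) \<partial>lborel)"
      by (auto simp: emeasure_density intro!: nn_integral_cong split: split_indicator)
    also have "\<dots> = ennreal (\<integral>t. indicator B t * f t \<partial>lborel)"
      using nonneg integrable_mult_indicator[OF _ f, of B]
      by (intro nn_integral_eq_integral) auto
    also have "\<dots> = emeasure \<mu> B"
      using eq[OF B] by (simp add: set_lebesgue_integral_def emeasure_eq_measure)
    finally show "emeasure \<mu> B = emeasure (density lborel (\<lambda>t. ennreal (f t))) B"
      by simp
  qed simp
  then show ?thesis
    using nonneg real_distribution_axioms by (simp add: has_pdf_def)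
qed

lemma has_pdf_distr_mixture:
  assumes [measurable]: "g \<in> borel_measurable borel"
    and T: "has_pdf T (\<lambda>t. \<Sum>i\<in>I. A i * f i t)"
    and X: "\<And>i. i \<in> I \<Longrightarrow> has_pdf (X i) (f i)"
    and h: "\<And>i. i \<in> I \<Longrightarrow> has_pdf (distr (X i) borel g) (h i)"
  shows "has_pdf (distr T borel g) (\<lambda>t. \<Sum>i\<in>I. A i * h i t)"
proof -
  \<comment> \<open>Used twice: for the \<open>h i\<close> over \<open>B\<close>, and for the
    \<open>f i\<close> over the preimage of \<open>B\<close> under \<open>g\<close>. The two
    resulting sums of measures agree term by term.\<close>
  have set_sum: "(LINT t:B|lborel. \<Sum>i\<in>I. A i * k i t) = (\<Sum>i\<in>I. A i * measure (Y i) B)"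
    if k: "\<And>i. i \<in> I \<Longrightarrow> has_pdf (Y i) (k i)" and B: "B \<in> sets borel" for B k Y
  proof -
    have "(LINT t:B|lborel. \<Sum>i\<in>I. A i * k i t) = (\<Sum>i\<in>I. LINT t:B|lborel. A i * k i t)"
      unfolding set_lebesgue_integral_def scaleR_sum_right
      using integrable_mult_indicator[OF _ integrable_mult_right[OF has_pdf_integral(1)[OF k]]] B
      by (intro Bochner_Integration.integral_sum) simp
    also have "\<dots> = (\<Sum>i\<in>I. A i * measure (Y i) B)"
      using has_pdf_integral(2)[OF k B] by (intro sum.cong) auto
    finally show ?thesis .
  qed
  interpret T: real_distribution T
    using T unfolding has_pdf_def by blast
  show ?thesis
  proof (rule has_pdfI)
    show "real_distribution (distr T borel g)"
      by (intro real_distribution.intro T.prob_space_distr) (auto simp: real_distribution_axioms_def)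
    show "integrable lborel (\<lambda>t. \<Sum>i\<in>I. A i * h i t)"
      using has_pdf_integral(1)[OF h] by (intro Bochner_Integration.integrable_sum) auto
    fix B :: "real set" assume B[measurable]: "B \<in> sets borel"
    have gB: "g -` B \<in> sets borel"
      using measurable_sets[OF assms(1) B] by simp
    have "measure (distr (X i) borel g) B = measure (X i) (g -` B)" if "i \<in> I" for i
    proof -
      interpret X: real_distribution "X i"
        using X[OF that] unfolding has_pdf_def by blast
      show ?thesis
        by (simp add: measure_distr)
    qed
    then have "(LINT t:B|lborel. \<Sum>i\<in>I. A i * h i t) = (\<Sum>i\<in>I. A i * measure (X i) (g -` B))"
      using set_sum[OF h B] by simp
    also have "\<dots> = measure T (g -` B)"
      using set_sum[OF X gB] has_pdf_integral(2)[OF T gB] by simp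
    finally show "(LINT t:B|lborel. \<Sum>i\<in>I. A i * h i t) = measure (distr T borel g) B"
      by (simp add: measure_distr)
  qed
qed

lemma has_pdf_unique: "has_pdf \<mu> f \<Longrightarrow> has_pdf \<nu> f \<Longrightarrow> \<mu> = \<nu>"
  by (simp add: has_pdf_def)

lemma mixed_TG_imp_eq_distr:
  assumes "mixed_TG T g Z"
  shows "Z = distr T borel g"
proof -
  from assms obtain m A X where "mixed_TG_via m A X T g Z"
    unfolding mixed_TG_def by blast
  then obtain f h where g: "g \<in> borel_measurable borel"
    and T: "has_pdf T (\<lambda>t. \<Sum>i=1..m. A i * f i t)"
    and Z: "has_pdf Z (\<lambda>t. \<Sum>i=1..m. A i * h i t)"
    and X: "\<forall>i\<in>{1..m}. has_pdf (X i) (f i)"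
    and h: "\<forall>i\<in>{1..m}. has_pdf (distr (X i) borel g) (h i)"
    unfolding mixed_TG_via_def by auto
  show ?thesis
    using has_pdf_unique[OF Z has_pdf_distr_mixture[OF g T X[rule_format] h[rule_format]]] .
qed

section \<open>Exponential and Pareto laws\<close>

lemma has_pdf_exponential_law:
  assumes "a > 0"
  shows "has_pdf (exponential_law a) (exponential_density a)"
  using assms prob_space_exponential_density[OF assms]
  by (auto simp: has_pdf_def exponential_law_def exponential_density_nonneg
      real_distribution_def real_distribution_axioms_def)

text \<open>Distribution functions are compared: for t \<ge> c the event c e^X \<le> t is X \<le> ln
  (t / c), of probability 1 - exp (- a ln (t / c)) = 1 - (c / t)^a. Thus the rate becomes the shape
  and the factor \<open>c\<close> becomes the scale.\<close>

lemma has_pdf_distr_exponential_law: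
  assumes a: "a > 0" and c: "c > 0"
  shows "has_pdf (distr (exponential_law a) borel (\<lambda>x. c * exp x)) (pareto_density a c)"
proof -
  interpret E: real_distribution "exponential_law a"
    using has_pdf_exponential_law[OF a] unfolding has_pdf_def by blast
  have [measurable]: "pareto_density a c \<in> borel_measurable borel"
    by (simp add: pareto_density_def[abs_def])
  have nonneg: "0 \<le> pareto_density a c t" for t
    using a c by (simp add: pareto_density_def)
  \<comment> \<open>The Pareto distribution function, extended by 0 below the scale.\<close>
  define G where "G t = (if t < c then 0 else 1 - (c / t) powr a)" for t
  have "distributed (exponential_law a) lborel (\<lambda>x. c * exp x) (pareto_density a c)"
  proof (rule distributedI_borel_atMost)
    fix t :: real
    show "(\<integral>\<^sup>+x. pareto_density a c x * indicator {..t} x \<partial>lborel) = ennreal (G t)"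
    proof (cases "t < c")
      case True
      then have "(\<integral>\<^sup>+x. pareto_density a c x * indicator {..t} x \<partial>lborel) = (\<integral>\<^sup>+x. 0 \<partial>(lborel::real measure))"
        by (intro nn_integral_cong) (auto simp: pareto_density_def split: split_indicator)
      with True show ?thesis
        by (simp add: G_def)
    next
      case False
      have "(\<integral>\<^sup>+x. pareto_density a c x * indicator {..t} x \<partial>lborel)
          = (\<integral>\<^sup>+x. ennreal (a * c powr a / x powr (a + 1)) * indicator {c..t} x \<partial>lborel)"
        by (intro nn_integral_cong) (auto simp: pareto_density_def split: split_indicator)
      also have "\<dots> = ennreal (- (c powr a * t powr - a) - - (c powr a * c powr - a))"
      proof (rule nn_integral_FTC_Icc)
        fix x assume x: "x \<in> {c..t}"
        then show "((\<lambda>x. - (c powr a * x powr - a)) has_real_derivative a * c powr a / x powr (a + 1)) (at x)"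
          using c by (auto intro!: derivative_eq_intros simp: powr_diff powr_add powr_minus field_simps)
        show "0 \<le> a * c powr a / x powr (a + 1)"
          using a by simp
      qed (use False in auto)
      also have "- (c powr a * t powr - a) - - (c powr a * c powr - a) = G t"
        using False c by (simp add: G_def powr_minus powr_divide field_simps)
      finally show ?thesis .
    qed
    show "emeasure (exponential_law a) {x \<in> space (exponential_law a). c * exp x \<le> t} = ennreal (G t)"
    \<comment> \<open>The split is at 0 and not at \<open>c\<close>, because
      \<open>ln (t / c)\<close> describes the event for every positive \<open>t\<close>.\<close>
    proof (cases "t > 0")
      case False
      have "t < c * exp x" for x
        using False c mult_pos_pos[OF c exp_gt_zero[of x]] by linarith
      then have "{x \<in> space (exponential_law a). c * exp x \<le> t} = {}"
        by (auto simp: not_le)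
      then show ?thesis
        using False c by (simp add: G_def)
    next
      case True
      then have "c * exp x \<le> t \<longleftrightarrow> x \<le> ln (t / c)" for x
        using c by (subst ln_ge_iff) (auto simp: field_simps)
      then have "{x \<in> space (exponential_law a). c * exp x \<le> t} = {..ln (t / c)}"
        by (auto simp: exponential_law_def)
      \<comment> \<open>The exponential law is the Erlang law of index 0. For
        \<open>0 < t < c\<close> the argument \<open>ln (t / c)\<close> is negative, and both
        \<open>erlang_CDF\<close> and \<open>G\<close> are 0.\<close>
      then have "emeasure (exponential_law a) {x \<in> space (exponential_law a). c * exp x \<le> t}
          = ennreal (erlang_CDF 0 a (ln (t / c)))"
        using emeasure_erlang_density[of a 0 "ln (t / c)"] a by (simp add: exponential_law_def)
      also have "erlang_CDF 0 a (ln (t / c)) = G t"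
        using True c
        by (auto simp: erlang_CDF_0 G_def ln_div powr_def field_simps)
      finally show ?thesis .
    qed
  qed (auto simp: nonneg exponential_law_def)
  then have "distr (exponential_law a) borel (\<lambda>x. c * exp x) = density lborel (pareto_density a c)"
    by (subst distributed_distr_eq_density[symmetric]) (auto intro: distr_cong)
  moreover have "real_distribution (distr (exponential_law a) borel (\<lambda>x. c * exp x))"
    by (intro real_distribution.intro E.prob_space_distr) (auto simp: real_distribution_axioms_def)
  ultimately show ?thesis
    using nonneg by (simp add: has_pdf_def)
qed

section \<open>Convolution with one more exponential law\<close>

lemma prob_space_exponential_law: "a > 0 \<Longrightarrow> prob_space (exponential_law a)"
  by (simp add: exponential_law_def prob_space_exponential_density)

lemma sets_exponential_law [simp, measurable_cong]: "sets (exponential_law a) = sets borel"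
  by (simp add: exponential_law_def)

text \<open>The enlarged product is the image of the pair of the new factor and the old product
  under updating at \<open>i\<close>; the sum then becomes the addition of two independent
  coordinates.\<close>

lemma distr_sum_PiM_insert:
  fixes M :: "'i \<Rightarrow> real measure"
  assumes "finite I" "i \<notin> I" and prob: "\<And>j. j \<in> insert i I \<Longrightarrow> prob_space (M j)"
    and sets[measurable_cong]: "\<And>j. sets (M j) = sets borel"
  shows "distr (Pi\<^sub>M (insert i I) M) borel (\<lambda>x. \<Sum>j\<in>insert i I. x j)
      = convolution (M i) (distr (Pi\<^sub>M I M) borel (\<lambda>x. \<Sum>j\<in>I. x j))"
proof -
  interpret PI: prob_space "Pi\<^sub>M I M"
    using prob by (intro prob_space_PiM) auto
  interpret S: prob_space "distr (Pi\<^sub>M I M) borel (\<lambda>x. \<Sum>j\<in>I. x j)"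
    by (intro PI.prob_space_distr) measurable
  have sum_upd: "(\<Sum>j\<in>insert i I. (X(i := x)) j) = x + (\<Sum>j\<in>I. X j)" for x and X :: "'i \<Rightarrow> real"
    using assms(1,2) by (auto intro!: sum.cong)
  have "distr (Pi\<^sub>M (insert i I) M) borel (\<lambda>x. \<Sum>j\<in>insert i I. x j)
      = distr (M i \<Otimes>\<^sub>M Pi\<^sub>M I M) borel (\<lambda>(x, X). x + (\<Sum>j\<in>I. X j))"
    by (subst distr_pair_PiM_eq_PiM[symmetric])
      (use prob in \<open>auto simp: distr_distr o_def case_prod_unfold sum_upd simp del: fun_upd_apply intro!: distr_cong\<close>)
  \<comment> \<open>The identity image of \<open>M i\<close> is inserted so that both factors are
    images and \<open>pair_measure_distr\<close> applies.\<close>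
  also have "\<dots> = distr (distr (M i) borel (\<lambda>x. x) \<Otimes>\<^sub>M distr (Pi\<^sub>M I M) borel (\<lambda>x. \<Sum>j\<in>I. x j))
      borel (\<lambda>(x, y). x + y)"
    by (subst pair_measure_distr)
      (auto simp: distr_distr o_def case_prod_unfold S.sigma_finite_measure_axioms intro!: distr_cong)
  also have "distr (M i) borel (\<lambda>x. x) = M i"
    using sets by (intro distr_id2) simp
  finally show ?thesis
    by (simp add: convolution_def)
qed

lemma exponential_mixture_nonneg:
  assumes nonneg: "\<And>y. 0 \<le> (\<Sum>i\<in>I. w i * exponential_density (a i) y)"
  shows "y \<ge> 0 \<Longrightarrow> 0 \<le> (\<Sum>i\<in>I. w i * (a i * exp (- y * a i)))"
  using nonneg[of y] by (simp add: exponential_density_def)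

text \<open>For rates a \<noteq> b the convolution of the two exponential densities is a b / (b - a)
  (e^(-a x) - e^(-b x)) for x \<ge> 0, which is f_a / (1 - a / b) + f_b / (1 - b / a); the claim is
  the weighted sum of these. Only the whole mixture is assumed nonnegative, as single weights may be
  negative.\<close>

lemma convolution_exponential_mixture:
  fixes a w :: "'i \<Rightarrow> real"
  assumes b: "b > 0" and a: "\<And>i. i \<in> I \<Longrightarrow> a i > 0 \<and> a i \<noteq> b"
    and nonneg: "\<And>y. 0 \<le> (\<Sum>i\<in>I. w i * exponential_density (a i) y)"
  defines "f \<equiv> \<lambda>x. (\<Sum>i\<in>I. w i / (1 - a i / b) * exponential_density (a i) x)
      + (\<Sum>i\<in>I. w i / (1 - b / a i)) * exponential_density b x"
  shows "(\<integral>\<^sup>+y. ennreal (exponential_density b (x - y)) *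
      ennreal (\<Sum>i\<in>I. w i * exponential_density (a i) y) \<partial>lborel) = ennreal (f x)"
    and "0 \<le> f x"
proof -
  \<comment> \<open>\<open>u\<close> is the integrand with the cutoffs at 0 removed, hence
    differentiable everywhere, and \<open>U\<close> is its termwise antiderivative.\<close>
  define u where "u y = b * exp (- (x - y) * b) * (\<Sum>i\<in>I. w i * (a i * exp (- y * a i)))" for y
  define U where "U y = (\<Sum>i\<in>I. w i * (a i * b / (b - a i)) * exp ((b - a i) * y - b * x))" for y
  have u_nonneg: "0 \<le> u y" if "y \<ge> 0" for y
    using exponential_mixture_nonneg[OF nonneg that] b by (simp add: u_def)
  have DU: "(U has_real_derivative u y) (at y)" for y
  proof -
    have "(U has_real_derivative (\<Sum>i\<in>I. w i * (a i * b / (b - a i)) *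
        (exp ((b - a i) * y - b * x) * (b - a i)))) (at y)"
      unfolding U_def[abs_def] by (intro DERIV_sum DERIV_cmult) (auto intro!: derivative_eq_intros)
    also have "(\<Sum>i\<in>I. w i * (a i * b / (b - a i)) * (exp ((b - a i) * y - b * x) * (b - a i))) = u y"
      unfolding u_def sum_distrib_left
    proof (rule sum.cong[OF refl])
      fix i assume "i \<in> I"
      then have "b - a i \<noteq> 0"
        using a[of i] by simp
      moreover have "exp ((b - a i) * y - b * x) = exp (- (x - y) * b) * exp (- y * a i)"
        by (simp add: algebra_simps flip: exp_add)
      ultimately show "w i * (a i * b / (b - a i)) * (exp ((b - a i) * y - b * x) * (b - a i))
          = b * exp (- (x - y) * b) * (w i * (a i * exp (- y * a i)))"
        by simp
    qed
    finally show ?thesis .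
  qed
  \<comment> \<open>The upper end contributes the old exponentials in \<open>- a i * x\<close>, the
    lower end the new one in \<open>- b * x\<close>.\<close>
  have f_eq: "f x = U x - U 0" if "x \<ge> 0"
  proof -
    have "f x = (\<Sum>i\<in>I. w i / (1 - a i / b) * (a i * exp (- x * a i)) + w i / (1 - b / a i) * (b * exp (- x * b)))"
      using that by (simp add: f_def exponential_density_def sum.distrib sum_distrib_right)
    also have "\<dots> = (\<Sum>i\<in>I. w i * (a i * b / (b - a i)) * exp ((b - a i) * x - b * x)
        - w i * (a i * b / (b - a i)) * exp ((b - a i) * 0 - b * x))"
    proof (rule sum.cong[OF refl])
      fix i assume i: "i \<in> I"
      have "w i / (1 - a i / b) = w i * b / (b - a i)" "w i / (1 - b / a i) = - (w i * a i / (b - a i))"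
        using a[OF i] b by (simp_all add: divide_simps) (simp add: algebra_simps)
      then show "w i / (1 - a i / b) * (a i * exp (- x * a i)) + w i / (1 - b / a i) * (b * exp (- x * b))
        = w i * (a i * b / (b - a i)) * exp ((b - a i) * x - b * x)
          - w i * (a i * b / (b - a i)) * exp ((b - a i) * 0 - b * x)"
        by (simp add: algebra_simps)
    qed
    finally show ?thesis
      by (simp add: U_def sum_subtractf)
  qed
  have f_neg: "f x = 0" if "x < 0"
    using that by (simp add: f_def exponential_density_def)
  have [measurable]: "u \<in> borel_measurable borel"
    unfolding u_def[abs_def] by measurable
  \<comment> \<open>The cutoffs of the two densities, at \<open>y = 0\<close> and at
    \<open>y = x\<close>, leave the interval \<open>{0..x}\<close>.\<close>
  have "(\<integral>\<^sup>+y. ennreal (exponential_density b (x - y)) *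
      ennreal (\<Sum>i\<in>I. w i * exponential_density (a i) y) \<partial>lborel)
      = (\<integral>\<^sup>+y. ennreal (u y) * indicator {0..x} y \<partial>lborel)"
    using b by (intro nn_integral_cong)
      (auto simp: exponential_density_def u_def ennreal_mult' split: split_indicator)
  also have "\<dots> = ennreal (f x)"
  proof (cases "x \<ge> 0")
    case True
    then have "(\<integral>\<^sup>+y. ennreal (u y) * indicator {0..x} y \<partial>lborel) = ennreal (U x - U 0)"
      using DU u_nonneg by (intro nn_integral_FTC_Icc) auto
    then show ?thesis
      using True by (simp add: f_eq)
  qed (simp add: f_neg)
  finally show "(\<integral>\<^sup>+y. ennreal (exponential_density b (x - y)) *
      ennreal (\<Sum>i\<in>I. w i * exponential_density (a i) y) \<partial>lborel) = ennreal (f x)" .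
  \<comment> \<open>The equation under \<open>ennreal\<close> does not yield this; it follows from
    \<open>U\<close> being nondecreasing on \<open>{0..x}\<close>.\<close>
  show "0 \<le> f x"
  proof (cases "x \<ge> 0")
    case True
    then have "U 0 \<le> U x"
      using DU u_nonneg by (intro DERIV_nonneg_imp_nondecreasing[of 0 x U]) blast+
    then show ?thesis
      using True by (simp add: f_eq)
  qed (simp add: f_neg)
qed

section \<open>Product weights and the hypoexponential density\<close>

text \<open>The Lagrange basis polynomial of the node \<open>a i\<close>, evaluated at \<open>0\<close>.\<close>

definition lagrange_weight :: "'i set \<Rightarrow> ('i \<Rightarrow> real) \<Rightarrow> 'i \<Rightarrow> real" where
  "lagrange_weight I a i = 1 / (\<Prod>j\<in>I - {i}. 1 - a i / a j)"

text \<open>Multiplied by the product on the right, each summand turns into a Lagrange basis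
  polynomial at \<open>x\<close>. A new rate as \<open>x\<close> gives the weight of that rate in
  the induction below; \<open>x = 0\<close> shows that the weights sum to 1.\<close>

lemma sum_lagrange_weight_at:
  assumes "finite I" "I \<noteq> {}" "inj_on a I"
    and a: "\<And>i. i \<in> I \<Longrightarrow> a i \<noteq> 0" and x: "\<And>i. i \<in> I \<Longrightarrow> x \<noteq> a i"
  shows "(\<Sum>i\<in>I. lagrange_weight I a i / (1 - x / a i)) = 1 / (\<Prod>j\<in>I. 1 - x / a j)"
proof -
  have "(\<Sum>i\<in>I. lagrange_weight I a i / (1 - x / a i)) * (\<Prod>j\<in>I. 1 - x / a j)
      = (\<Sum>i\<in>I. \<Prod>j\<in>I - {i}. (x - a j) / (a i - a j))"
    unfolding sum_distrib_right
  proof (rule sum.cong[OF refl])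
    fix i assume i: "i \<in> I"
    have "1 - x / a i \<noteq> 0"
      using a[OF i] x[OF i] by simp
    then have "lagrange_weight I a i / (1 - x / a i) * (\<Prod>j\<in>I. 1 - x / a j)
        = (\<Prod>j\<in>I - {i}. (1 - x / a j) / (1 - a i / a j))"
      using assms(1) i by (simp add: lagrange_weight_def prod.remove[of I i] prod_dividef)
    also have "\<dots> = (\<Prod>j\<in>I - {i}. (x - a j) / (a i - a j))"
    proof (rule prod.cong[OF refl])
      fix j assume j: "j \<in> I - {i}"
      then have "a i - a j \<noteq> 0" "a j - a i \<noteq> 0"
        using inj_onD[OF assms(3), of i j] i by auto
      then show "(1 - x / a j) / (1 - a i / a j) = (x - a j) / (a i - a j)"
        using j a[of j] by (simp add: divide_simps) (simp add: algebra_simps)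
    qed
    finally show "lagrange_weight I a i / (1 - x / a i) * (\<Prod>j\<in>I. 1 - x / a j)
        = (\<Prod>j\<in>I - {i}. (x - a j) / (a i - a j))" .
  qed
  also have "\<dots> = 1"
    by (rule sum_lagrange_basis) fact+
  finally show ?thesis
    by (metis eq_divide_eq mult_zero_right zero_neq_one)
qed

text \<open>Induction over the index set, convolving with one rate at a time. Pointwise
  nonnegativity is carried along because the convolution step requires it of the previous
  mixture.\<close>

lemma distr_sum_exponential_laws:
  fixes a :: "'i \<Rightarrow> real"
  assumes "finite I" "I \<noteq> {}" "\<And>i. i \<in> I \<Longrightarrow> a i > 0" "inj_on a I"
  defines "f \<equiv> \<lambda>t. \<Sum>i\<in>I. lagrange_weight I a i * exponential_density (a i) t"
  shows "distr (Pi\<^sub>M I (\<lambda>i. exponential_law (a i))) borel (\<lambda>x. \<Sum>i\<in>I. x i) = density lborel (\<lambda>t. ennreal (f t))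
    \<and> (\<forall>t. 0 \<le> f t)"
  using assms(1-4) unfolding f_def
proof (induction rule: finite_ne_induct)
  case (singleton i)
  have "distr (Pi\<^sub>M {i} (\<lambda>j. exponential_law (a j))) borel (\<lambda>x. x i)
      = distr (Pi\<^sub>M {i} (\<lambda>j. exponential_law (a j))) (exponential_law (a i)) (\<lambda>x. x i)"
    by (intro distr_cong) auto
  also have "\<dots> = exponential_law (a i)"
    using singleton by (intro distr_PiM_component prob_space_exponential_law) auto
  finally show ?case
    using singleton by (simp add: lagrange_weight_def exponential_law_def exponential_density_nonneg)
next
  case (insert k I)
  define F where "F t = (\<Sum>i\<in>I. lagrange_weight I a i * exponential_density (a i) t)" for t
  have law_I: "distr (Pi\<^sub>M I (\<lambda>i. exponential_law (a i))) borel (\<lambda>x. \<Sum>i\<in>I. x i) = density lborel (\<lambda>t. ennreal (F t))"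
    and F_nonneg: "\<And>t. 0 \<le> F t"
    using insert.IH insert.prems by (simp_all add: F_def)
  have a: "a i > 0 \<and> a i \<noteq> a k" if "i \<in> I" for i
    using insert.prems(1)[of i] inj_on_eq_iff[OF insert.prems(2), of i k] insert.hyps that by auto
  have ak: "a k > 0"
    using insert.prems by simp
  have new: "(\<Sum>i\<in>I. lagrange_weight I a i / (1 - a k / a i)) = lagrange_weight (insert k I) a k"
  proof -
    have "(\<Sum>i\<in>I. lagrange_weight I a i / (1 - a k / a i)) = 1 / (\<Prod>j\<in>I. 1 - a k / a j)"
      using insert.hyps insert.prems(2) a by (intro sum_lagrange_weight_at) (auto simp: less_imp_neq dest: a)
    then show ?thesis
      using insert.hyps by (simp add: lagrange_weight_def)
  qed
  \<comment> \<open>An old weight only gains the factor for \<open>j = k\<close> in its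
    denominator.\<close>
  have old: "lagrange_weight (insert k I) a i = lagrange_weight I a i / (1 - a i / a k)" if "i \<in> I" for i
  proof -
    have "insert k I - {i} = insert k (I - {i})"
      using insert.hyps that by auto
    then show ?thesis
      using insert.hyps by (simp add: lagrange_weight_def)
  qed
  let ?f = "\<lambda>t. \<Sum>i\<in>insert k I. lagrange_weight (insert k I) a i * exponential_density (a i) t"
  have f_eq: "?f t = (\<Sum>i\<in>I. lagrange_weight I a i / (1 - a i / a k) * exponential_density (a i) t)
      + (\<Sum>i\<in>I. lagrange_weight I a i / (1 - a k / a i)) * exponential_density (a k) t" for t
    using insert.hyps by (simp add: new old)
  note conv = convolution_exponential_mixture[OF ak a F_nonneg[unfolded F_def], folded f_eq F_def]
  have [measurable]: "F \<in> borel_measurable borel"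
    unfolding F_def[abs_def] by measurable
  have "prob_space (density lborel (\<lambda>t. ennreal (F t)))"
    unfolding law_I[symmetric] using a
    by (intro prob_space.prob_space_distr prob_space_PiM prob_space_exponential_law) auto
  moreover have "distr (Pi\<^sub>M (insert k I) (\<lambda>i. exponential_law (a i))) borel (\<lambda>x. \<Sum>i\<in>insert k I. x i)
      = convolution (exponential_law (a k)) (density lborel (\<lambda>t. ennreal (F t)))"
    unfolding law_I[symmetric] using insert.hyps insert.prems(1)
    by (intro distr_sum_PiM_insert prob_space_exponential_law) auto
  ultimately have "distr (Pi\<^sub>M (insert k I) (\<lambda>i. exponential_law (a i))) borel (\<lambda>x. \<Sum>i\<in>insert k I. x i)
      = density lborel (\<lambda>x. \<integral>\<^sup>+y. ennreal (exponential_density (a k) (x - y)) * ennreal (F y) \<partial>lborel)"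
    using prob_space_exponential_law[OF ak] unfolding exponential_law_def
    by (simp add: convolution_density prob_space.finite_measure prob_space_imp_subprob_space)
  then show ?case
    using conv by (simp only: simp_thms)
qed

lemma has_pdf_hypoexponential_law:
  assumes "n \<ge> 1" "\<forall>i\<in>{1..n}. \<alpha> i > 0" "inj_on \<alpha> {1..n}"
  shows "has_pdf (hypoexponential_law n \<alpha>)
    (\<lambda>t. \<Sum>i=1..n. 1 / hypoexp_coeff n \<alpha> i * exponential_density (\<alpha> i) t)"
proof -
  have "prob_space (hypoexponential_law n \<alpha>)"
    unfolding hypoexponential_law_def using assms
    by (intro prob_space.prob_space_distr prob_space_PiM prob_space_exponential_law) auto
  moreover have "hypoexponential_law n \<alpha> = density lborel
      (\<lambda>t. ennreal (\<Sum>i=1..n. 1 / hypoexp_coeff n \<alpha> i * exponential_density (\<alpha> i) t))"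
    "\<And>t. 0 \<le> (\<Sum>i=1..n. 1 / hypoexp_coeff n \<alpha> i * exponential_density (\<alpha> i) t)"
    using distr_sum_exponential_laws[of "{1..n}" \<alpha>] assms
    by (auto simp: hypoexponential_law_def hypoexp_coeff_def lagrange_weight_def)
  ultimately show ?thesis
    by (auto simp: has_pdf_def real_distribution_def real_distribution_axioms_def hypoexponential_law_def)
qed

section \<open>Existence, uniqueness and density of the mixed law\<close>

theorem theorem11:
  fixes n :: nat and \<alpha> :: "nat \<Rightarrow> real" and c :: real
  assumes "n \<ge> 2"
    and "\<forall>i\<in>{1..n}. \<alpha> i > 0"
    and "inj_on \<alpha> {1..n}"
    and "c > 0"
  shows "has_pdf (hypoexponential_law n \<alpha>)
           (\<lambda>t. \<Sum>i=1..n. exponential_density (\<alpha> i) t / hypoexp_coeff n \<alpha> i) \<and>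
         (\<forall>i\<in>{1..n}. has_pdf (distr (exponential_law (\<alpha> i)) borel (\<lambda>x. c * exp x))
           (pareto_density (\<alpha> i) c)) \<and>
         (\<exists>!Z. mixed_hypoexponential_pareto n c \<alpha> Z) \<and>
         (\<forall>Z. mixed_hypoexponential_pareto n c \<alpha> Z \<longrightarrow>
           mixed_TG_via n (\<lambda>i. 1 / hypoexp_coeff n \<alpha> i) (\<lambda>i. exponential_law (\<alpha> i))
             (hypoexponential_law n \<alpha>) (\<lambda>x. c * exp x) Z \<and>
           has_pdf Z (\<lambda>t. \<Sum>i=1..n. 1 / hypoexp_coeff n \<alpha> i * pareto_density (\<alpha> i) c t))"
proof -
  let ?g = "\<lambda>x. c * exp x" and ?T = "hypoexponential_law n \<alpha>"
  let ?A = "\<lambda>i. 1 / hypoexp_coeff n \<alpha> i" and ?X = "\<lambda>i. exponential_law (\<alpha> i)"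
  have T: "has_pdf ?T (\<lambda>t. \<Sum>i=1..n. ?A i * exponential_density (\<alpha> i) t)"
    using assms by (intro has_pdf_hypoexponential_law) auto
  have X: "has_pdf (?X i) (exponential_density (\<alpha> i))" if "i \<in> {1..n}" for i
    using assms that by (intro has_pdf_exponential_law) auto
  have h: "has_pdf (distr (?X i) borel ?g) (pareto_density (\<alpha> i) c)" if "i \<in> {1..n}" for i
    using assms that by (intro has_pdf_distr_exponential_law) auto
  have Z: "has_pdf (distr ?T borel ?g) (\<lambda>t. \<Sum>i=1..n. ?A i * pareto_density (\<alpha> i) c t)"
    by (rule has_pdf_distr_mixture[OF _ T X h]) auto
  have "\<alpha> i \<noteq> 0" if "i \<in> {1..n}" for i
    using assms(2) that by fastforce
  then have sum_A: "(\<Sum>i=1..n. ?A i) = 1"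
    using sum_lagrange_weight_at[of "{1..n}" \<alpha> 0] assms(1-3)
    by (auto simp: lagrange_weight_def hypoexp_coeff_def)
  have inj_g: "inj ?g"
    using assms by (auto simp: inj_def)
  have via: "mixed_TG_via n ?A ?X ?T ?g (distr ?T borel ?g)"
    unfolding mixed_TG_via_def
  proof (intro conjI exI ballI)
    show "?g \<in> borel_measurable borel"
      by measurable
    show "has_pdf ?T (\<lambda>t. \<Sum>i=1..n. ?A i * exponential_density (\<alpha> i) t)"
      by (fact T)
    show "has_pdf (distr ?T borel ?g) (\<lambda>t. \<Sum>i=1..n. ?A i * pareto_density (\<alpha> i) c t)"
      by (fact Z)
  qed (use sum_A inj_g X h in simp_all)
  \<comment> \<open>The image law is the only candidate, and the representation \<open>via\<close>
    shows that it qualifies; the claims about all \<open>Z\<close> thus concern this one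
    measure.\<close>
  have iff: "mixed_hypoexponential_pareto n c \<alpha> Z \<longleftrightarrow> Z = distr ?T borel ?g" for Z
  proof
    assume "mixed_hypoexponential_pareto n c \<alpha> Z"
    then show "Z = distr ?T borel ?g"
      unfolding mixed_hypoexponential_pareto_def by (rule mixed_TG_imp_eq_distr)
  next
    assume "Z = distr ?T borel ?g"
    then show "mixed_hypoexponential_pareto n c \<alpha> Z"
      unfolding mixed_hypoexponential_pareto_def mixed_TG_def using via by (intro exI) simp
  qed
  show ?thesis
    unfolding iff using T h via Z by simp
qed

end
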